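(* Let $k,s'\ge 2$ be integers and let $c'$ be an $s'$-edge-colouring of the clique $K_k$ that uses exactly $s'$ colours. Then the Erdős–Hajnal conjecture holds for $c'$, i.e. $c'$ has the EH-property for $s$ colours for every integer $s\ge s'$, if and only if $c'$ has the EH-property for $s'$ colours and the EH-property for $s'+1$ colours.
   Context: A clique of size $n$ is a complete graph $K_n$ on $n$ vertices; write $[m]=\{1,\dots,m\}$. For a positive integer $s$, an $s$-edge-colouring of $K_n$ on vertex set $[n]$ is any map $\binom{[n]}{2}\to[s]$ (not necessarily surjective). Let $s\ge s'$, let $c$ be an $s$-edge-colouring of $K_n$ on vertex set $V$, and let $c'$ be an $s'$-edge-colouring of $K_k$ (on vertex set $[k]$). A copy of $c'$ in $c$ is a set $U\subseteq V$ with $|U|=k$ for which there is a bijection $\phi:U\to[k]$ such that $c(xy)=c'(\phi(x)\phi(y))$ for all distinct $x,y\in U$ (colours are preserved exactly). The colouring $c$ is $c'$-free if there is no copy of $c'$ in $c$. A homogeneous set in an $s$-edge-colouring $c$ of $K_n$ is a set $X$ of vertices such that $|\{c(xy): x,y\in X,\ x\ne y\}|<s$, i.e. at least one colour of $[s]$ does not appear on the edges inside $X$. The size of a largest homogeneous set in $c$ is denoted $h_s(c)$. Define $$h_s(n,c')=\min\{h_s(c) : c \text{ is a } c'\text{-free } s\text{-edge-colouring of } K_n\}.$$ For $s\ge s'$, the colouring $c'$ has the EH-property for $s$ colours if there are constants $\epsilon>0$ and $C>0$ (depending only on $c'$ and $s$) such that $h_s(n,c')\ge C n^{\epsilon}$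 for all $n$. *)

theory Defs
  imports Complex_Main "HOL-Library.Ramsey"
begin

text \<open>
  The edges of the complete graph on a vertex set \<open>V\<close> are the two-element subsets \<open>nsets V 2\<close>.
  Colourings are extensional functions, so that they correspond one-to-one to maps on the edge set
  and there are only finitely many of them when \<open>V\<close> is finite.
\<close>

definition edge_colourings :: "nat \<Rightarrow> 'a set \<Rightarrow> ('a set \<Rightarrow> nat) set" where
  "edge_colourings s V = nsets V 2 \<rightarrow>\<^sub>E {1..s}"

definition is_copy :: "nat \<Rightarrow> (nat set \<Rightarrow> nat) \<Rightarrow> 'a set \<Rightarrow> ('a set \<Rightarrow> nat) \<Rightarrow> 'a set \<Rightarrow> bool" where
  "is_copy k c' V c U \<longleftrightarrow> U \<subseteq> V \<and> card U = k \<and>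
     (\<exists>\<phi>. bij_betw \<phi> U {1..k} \<and> (\<forall>x\<in>U. \<forall>y\<in>U. x \<noteq> y \<longrightarrow> c {x, y} = c' {\<phi> x, \<phi> y}))"

definition colouring_free :: "nat \<Rightarrow> (nat set \<Rightarrow> nat) \<Rightarrow> 'a set \<Rightarrow> ('a set \<Rightarrow> nat) \<Rightarrow> bool" where
  "colouring_free k c' V c \<longleftrightarrow> \<not> (\<exists>U. is_copy k c' V c U)"

definition homogeneous :: "nat \<Rightarrow> 'a set \<Rightarrow> ('a set \<Rightarrow> nat) \<Rightarrow> 'a set \<Rightarrow> bool" where
  "homogeneous s V c X \<longleftrightarrow> X \<subseteq> V \<and> card {c {x, y} | x y. x \<in> X \<and> y \<in> X \<and> x \<noteq> y} < s"

text \<open>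
  For finite \<open>V\<close> and \<open>s \<ge> 1\<close> the maximum is over a finite set that is nonempty, since the empty
  set is homogeneous.
\<close>

definition hom_number :: "nat \<Rightarrow> 'a set \<Rightarrow> ('a set \<Rightarrow> nat) \<Rightarrow> nat" where
  "hom_number s V c = Max {card X | X. homogeneous s V c X}"

text \<open>
  If \<open>c'\<close> uses at least two colours and \<open>s \<ge> 1\<close>, the minimum is over a finite set that is
  nonempty, since a colouring with a single colour is \<open>c'\<close>-free.
\<close>

definition min_hom_number :: "nat \<Rightarrow> nat \<Rightarrow> nat \<Rightarrow> (nat set \<Rightarrow> nat) \<Rightarrow> nat" where
  "min_hom_number s n k c' =
     Min {hom_number s {1..n} c | c. c \<in> edge_colourings s {1..n} \<and> colouring_free k c' {1..n} c}"

definition EH_property :: "nat \<Rightarrow> nat \<Rightarrow> (nat set \<Rightarrow> nat) \<Rightarrow> bool" where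
  "EH_property s k c' \<longleftrightarrow>
     (\<exists>\<epsilon>>0. \<exists>C>0. \<forall>n. real (min_hom_number s n k c') \<ge> C * real n powr \<epsilon>)"

end

theory Submission
  imports Defs
begin

text \<open>
  Let \<open>s > s'\<close> and replace every colour above \<open>s' + 1\<close> of an \<open>s\<close>-edge-colouring \<open>c\<close> by \<open>s' + 1\<close>.
  Since \<open>c'\<close> uses only colours up to \<open>s'\<close>, the merged colouring is still \<open>c'\<close>-free, and a set that
  misses a merged colour misses at least one original colour. Hence the largest homogeneous set
  does not become larger by merging, so \<open>h\<^bsub>s'+1\<^esub>(n, c') \<le> h\<^sub>s(n, c')\<close>.
\<close>

definition merge_colours :: "nat \<Rightarrow> 'a set \<Rightarrow> ('a set \<Rightarrow> nat) \<Rightarrow> 'a set \<Rightarrow> nat" where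
  "merge_colours t V c = restrict (\<lambda>e. min t (c e)) (nsets V 2)"

lemma doubleton_in_nsets_2: "x \<in> V \<Longrightarrow> y \<in> V \<Longrightarrow> x \<noteq> y \<Longrightarrow> {x, y} \<in> nsets V 2"
  by (simp add: nsets_def)

lemma merge_colours_doubleton:
  "x \<in> V \<Longrightarrow> y \<in> V \<Longrightarrow> x \<noteq> y \<Longrightarrow> merge_colours t V c {x, y} = min t (c {x, y})"
  by (simp add: merge_colours_def doubleton_in_nsets_2)

lemma merge_colours_in_edge_colourings:
  assumes "1 \<le> t" "c \<in> edge_colourings s V"
  shows "merge_colours t V c \<in> edge_colourings t V"
  using assms by (auto simp: edge_colourings_def merge_colours_def PiE_iff)

lemma finite_edge_colourings: "finite V \<Longrightarrow> finite (edge_colourings s V)"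
  unfolding edge_colourings_def by (intro finite_PiE finite_imp_finite_nsets) auto

text \<open>A value of \<open>min t\<close> below \<open>t\<close> is the original colour, so a copy
  of \<open>c'\<close> in the merged colouring is a copy in \<open>c\<close> on the same set
  \<open>U\<close>. The bound on \<open>c'\<close> is strict because the merged colour
  \<open>t\<close> may stand for any colour from \<open>t\<close> upwards.\<close>

lemma colouring_free_merge_colours:
  assumes small: "\<And>e. e \<in> nsets {1..k} 2 \<Longrightarrow> c' e < t"
    and free: "colouring_free k c' V c"
  shows "colouring_free k c' V (merge_colours t V c)"
  unfolding colouring_free_def
proof
  assume "\<exists>U. is_copy k c' V (merge_colours t V c) U"
  then obtain U \<phi> where U: "U \<subseteq> V" "card U = k" and \<phi>: "bij_betw \<phi> U {1..k}"
    and eq: "\<And>x y. x \<in> U \<Longrightarrow> y \<in> U \<Longrightarrow> x \<noteq> y \<Longrightarrow> merge_colours t V c {x, y} = c' {\<phi> x, \<phi> y}"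
    unfolding is_copy_def by blast
  have "c {x, y} = c' {\<phi> x, \<phi> y}" if "x \<in> U" "y \<in> U" "x \<noteq> y" for x y
  proof -
    have "\<phi> x \<in> {1..k}" "\<phi> y \<in> {1..k}" "\<phi> x \<noteq> \<phi> y"
      using \<phi> that by (auto dest: bij_betwE simp: bij_betw_def inj_on_def)
    then have "c' {\<phi> x, \<phi> y} < t"
      by (intro small doubleton_in_nsets_2)
    moreover have "min t (c {x, y}) = c' {\<phi> x, \<phi> y}"
      using eq[OF that] U(1) that by (simp add: merge_colours_doubleton subset_iff)
    ultimately show ?thesis
      by linarith
  qed
  then have "is_copy k c' V c U"
    unfolding is_copy_def using U \<phi> by blast
  then show False
    using free unfolding colouring_free_def by blast
qed

text \<open>By contraposition: \<open>min t\<close> fixes each colour in \<open>{1..t}\<close> and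
  \<open>t \<le> s\<close>, so if all of \<open>{1..s}\<close> occurs on \<open>X\<close>, all of
  \<open>{1..t}\<close> occurs after merging.\<close>

lemma homogeneous_merge_colours:
  assumes "1 \<le> t" "t \<le> s" and c: "c \<in> edge_colourings s V"
    and hom: "homogeneous t V (merge_colours t V c) X"
  shows "homogeneous s V c X"
proof -
  let ?cols = "\<lambda>c :: 'a set \<Rightarrow> nat. {c {x, y} | x y. x \<in> X \<and> y \<in> X \<and> x \<noteq> y}"
  have X: "X \<subseteq> V" and card_lt: "card (?cols (merge_colours t V c)) < t"
    using hom by (auto simp: homogeneous_def)
  \<comment> \<open>This inclusion turns the cardinality bound to be shown into the absence of some
    colour of \<open>{1..s}\<close>.\<close>
  have sub: "?cols c \<subseteq> {1..s}"
  proof clarify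
    fix x y assume "x \<in> X" "y \<in> X" "x \<noteq> y"
    then have "{x, y} \<in> nsets V 2"
      using X by (intro doubleton_in_nsets_2) auto
    then show "c {x, y} \<in> {1..s}"
      using c unfolding edge_colourings_def by (rule PiE_mem[rotated])
  qed
  have "?cols c \<noteq> {1..s}"
  proof
    assume all: "?cols c = {1..s}"
    have "{1..t} \<subseteq> ?cols (merge_colours t V c)"
    proof
      fix i assume i: "i \<in> {1..t}"
      then have "i \<in> ?cols c"
        unfolding all using \<open>t \<le> s\<close> by simp
      then obtain x y where xy: "x \<in> X" "y \<in> X" "x \<noteq> y" "c {x, y} = i"
        by blast
      then have "merge_colours t V c {x, y} = i"
        using X i by (simp add: merge_colours_doubleton subset_iff)
      then show "i \<in> ?cols (merge_colours t V c)"
        using xy by blast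
    qed
    \<comment> \<open>An infinite set has \<open>card\<close> 0, so finiteness must be checked
      before comparing cardinalities; \<open>V\<close> and \<open>X\<close> may be infinite here,
      but merged colours are at most \<open>t\<close>.\<close>
    moreover have "finite (?cols (merge_colours t V c))"
    proof (rule finite_subset)
      show "?cols (merge_colours t V c) \<subseteq> {..t}"
        using X by (auto simp: merge_colours_doubleton subset_iff)
    qed simp
    ultimately have "t \<le> card (?cols (merge_colours t V c))"
      using card_mono[of "?cols (merge_colours t V c)" "{1..t}"] by simp
    then show False
      using card_lt by simp
  qed
  then have "card (?cols c) < card {1..s}"
    using sub by (intro psubset_card_mono) auto
  then show ?thesis
    using X by (simp add: homogeneous_def)
qed

lemma hom_number_merge_colours_le:
  assumes "finite V" "1 \<le> t" "t \<le> s" "c \<in> edge_colourings s V"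
  shows "hom_number t V (merge_colours t V c) \<le> hom_number s V c"
  unfolding hom_number_def
proof (rule Max_mono)
  show "{card X |X. homogeneous t V (merge_colours t V c) X} \<subseteq> {card X |X. homogeneous s V c X}"
    using homogeneous_merge_colours[OF assms(2-4)] by blast
  have "homogeneous t V (merge_colours t V c) {}"
    using \<open>1 \<le> t\<close> by (simp add: homogeneous_def)
  then show "{card X |X. homogeneous t V (merge_colours t V c) X} \<noteq> {}"
    by blast
  have "{card X |X. homogeneous s V c X} \<subseteq> card ` Pow V"
    by (auto simp: homogeneous_def)
  then show "finite {card X |X. homogeneous s V c X}"
    using \<open>finite V\<close> by (meson finite_Pow_iff finite_imageI finite_subset)
qed

text \<open>In the constant colouring 1, a copy of \<open>c'\<close> would force colour 1 on the
  edge \<open>e\<close>. This keeps the minimum in \<open>min_hom_number\<close> from ranging over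
  the empty set, where \<open>Min\<close> has no useful value.\<close>

lemma ex_colouring_free:
  assumes "1 \<le> s" and e: "e \<in> nsets {1..k} 2" "c' e \<noteq> 1"
  shows "\<exists>c \<in> edge_colourings s V. colouring_free k c' V c"
proof
  let ?c = "restrict (\<lambda>_. 1) (nsets V 2)"
  show "?c \<in> edge_colourings s V"
    using \<open>1 \<le> s\<close> by (auto simp: edge_colourings_def)
  show "colouring_free k c' V ?c"
    unfolding colouring_free_def
  proof
    assume "\<exists>U. is_copy k c' V ?c U"
    then obtain U \<phi> where U: "U \<subseteq> V" and \<phi>: "bij_betw \<phi> U {1..k}"
      and eq: "\<And>x y. x \<in> U \<Longrightarrow> y \<in> U \<Longrightarrow> x \<noteq> y \<Longrightarrow> ?c {x, y} = c' {\<phi> x, \<phi> y}"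
      unfolding is_copy_def by blast
    obtain a b where ab: "e = {a, b}" "a \<noteq> b" "a \<in> {1..k}" "b \<in> {1..k}"
      using e(1) by (auto simp: nsets_def card_2_iff)
    then obtain x y where "x \<in> U" "y \<in> U" "\<phi> x = a" "\<phi> y = b"
      using \<phi> unfolding bij_betw_def by (metis imageE)
    then show False
      using eq[of x y] U ab e(2) by (auto simp: doubleton_in_nsets_2 subset_iff)
  qed
qed

text \<open>A colouring attaining the minimum for \<open>s\<close> becomes, after merging, a
  candidate in the minimum for \<open>t\<close>, with a homogeneous number that is no
  larger.\<close>

lemma min_hom_number_mono:
  assumes "1 \<le> t" "t \<le> s"
    and small: "\<And>e. e \<in> nsets {1..k} 2 \<Longrightarrow> c' e < t"
    and e: "e \<in> nsets {1..k} 2" "c' e \<noteq> 1"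
  shows "min_hom_number t n k c' \<le> min_hom_number s n k c'"
proof -
  let ?V = "{1..n}"
  let ?H = "\<lambda>s. {hom_number s ?V c | c. c \<in> edge_colourings s ?V \<and> colouring_free k c' ?V c}"
  have fin: "finite (?H r)" for r
    using finite_edge_colourings[of ?V r] by simp
  have "?H s \<noteq> {}"
    using ex_colouring_free[where V = ?V and k = k and c' = c', OF _ e, of s] assms(1,2) by auto
  then have "Min (?H s) \<in> ?H s"
    by (intro Min_in fin)
  then obtain c where c: "c \<in> edge_colourings s ?V" "colouring_free k c' ?V c"
    and Min_eq: "Min (?H s) = hom_number s ?V c"
    by blast
  have "hom_number t ?V (merge_colours t ?V c) \<in> ?H t"
    using merge_colours_in_edge_colourings[OF \<open>1 \<le> t\<close> c(1)]
      colouring_free_merge_colours[OF small c(2)] by blast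
  then have "Min (?H t) \<le> hom_number t ?V (merge_colours t ?V c)"
    by (intro Min_le fin)
  also have "\<dots> \<le> hom_number s ?V c"
    using assms(1,2) c(1) by (intro hom_number_merge_colours_le) auto
  finally show ?thesis
    unfolding min_hom_number_def Min_eq .
qed

lemma EH_property_mono:
  assumes "EH_property t k c'" and "\<And>n. min_hom_number t n k c' \<le> min_hom_number s n k c'"
  shows "EH_property s k c'"
proof -
  obtain \<epsilon> C where "\<epsilon> > 0" "C > 0" and "\<And>n. C * real n powr \<epsilon> \<le> real (min_hom_number t n k c')"
    using assms(1) unfolding EH_property_def by blast
  then have "\<And>n. C * real n powr \<epsilon> \<le> real (min_hom_number s n k c')"
    using assms(2) by (meson of_nat_le_iff order_trans)
  then show ?thesis
    unfolding EH_property_def using \<open>\<epsilon> > 0\<close> \<open>C > 0\<close> by blast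
qed

theorem corollary1:
  fixes k s' :: nat and c' :: "nat set \<Rightarrow> nat"
  assumes "k \<ge> 2" and "s' \<ge> 2"
    and "c' \<in> edge_colourings s' {1..k}"
    and "c' ` nsets {1..k} 2 = {1..s'}"
  shows "(\<forall>s\<ge>s'. EH_property s k c') \<longleftrightarrow> EH_property s' k c' \<and> EH_property (s' + 1) k c'"
proof (intro iffI conjI allI impI)
  fix s
  assume EH: "EH_property s' k c' \<and> EH_property (s' + 1) k c'" and "s' \<le> s"
  \<comment> \<open>As \<open>s' \<ge> 2\<close>, colour 2 is used; an edge of that colour witnesses
    that \<open>c'\<close> is not constantly 1.\<close>
  have "2 \<in> c' ` nsets {1..k} 2"
    using assms(2,4) by simp
  then obtain e where e: "e \<in> nsets {1..k} 2" "c' e \<noteq> 1"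
    by force
  have small: "c' e < s' + 1" if "e \<in> nsets {1..k} 2" for e
    using imageI[OF that, of c'] assms(4) by simp
  show "EH_property s k c'"
  proof (cases "s = s'")
    \<comment> \<open>Now \<open>s' + 1 \<le> s\<close>, so merging down to \<open>s' + 1\<close>
      colours applies. The case \<open>s = s'\<close> needs its own hypothesis, since merging to
      \<open>t = s'\<close> would violate the strict bound on \<open>c'\<close>.\<close>
    case False
    then have "min_hom_number (s' + 1) n k c' \<le> min_hom_number s n k c'" for n
      using \<open>s' \<le> s\<close> small e by (intro min_hom_number_mono[where e = e]) auto
    then show ?thesis
      using EH EH_property_mono by blast
  qed (use EH in simp)
\<comment> \<open>What remains is the forward direction, the instances \<open>s = s'\<close> and
  \<open>s = s' + 1\<close>.\<close>
qed simp_all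

end
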